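(* Let $K$ be a field with $\mathrm{char}(K)\neq 2$ and let $(C_1,C_0,s,t,e,k)$ be a categorical Lie $K$-algebra. Let $\tau\colon C_0\times C_0\to C_1$, $(a,b)\mapsto\tau_{a,b}$, be a $K$-bilinear map such that (i) $s(\tau_{a,b})=[a,b]$ and $t(\tau_{a,b})=[b,a]$ for all $a,b\in C_0$; (ii) $k\big(([x,y],\tau_{t(x),t(y)})\big)=k\big((\tau_{s(x),s(y)},[y,x])\big)$ for all $x,y\in C_1$. Then, for all $a,b,c\in C_0$, \[\tau_{a,[b,c]}=[e(a),\tau_{b,c}]\quad\text{and}\quad \tau_{[b,c],a}=[\tau_{b,c},e(a)].\] In particular, $\tau_{a,[b,c]}=-\tau_{[b,c],a}$.
   Context: A categorical Lie $K$-algebra is an internal category in the category of Lie $K$-algebras: Lie algebras $C_1,C_0$ and Lie homomorphisms $s,t\colon C_1\to C_0$, $e\colon C_0\to C_1$, $k\colon C_1\times_{C_0}C_1\to C_1$, with $C_1\times_{C_0}C_1=\{(x,y)\in C_1\times C_1: t(x)=s(y)\}$, satisfying $se=te=\mathrm{Id}$, $s(k(x,y))=s(x)$, $t(k(x,y))=t(y)$, $k(e(s(x)),x)=x=k(x,e(t(x)))$, and associativity of $k$. *)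

theory Defs
  imports "HOL-Analysis.Product_Vector"
begin

locale lie_algebra = vector_space scale
  for scale :: "'k::field \<Rightarrow> 'a::ab_group_add \<Rightarrow> 'a" (infixr \<open>*s\<close> 75) +
  fixes bracket :: "'a \<Rightarrow> 'a \<Rightarrow> 'a"
  assumes bracket_linear_right: "Vector_Spaces.linear scale scale (bracket x)"
    and bracket_linear_left: "Vector_Spaces.linear scale scale (\<lambda>x. bracket x y)"
    and bracket_self: "bracket x x = 0"
    and jacobi: "bracket x (bracket y z) + bracket y (bracket z x) + bracket z (bracket x y) = 0"
begin

definition lie_subalgebra :: "'a set \<Rightarrow> bool" where
  "lie_subalgebra S \<longleftrightarrow> subspace S \<and> (\<forall>x\<in>S. \<forall>y\<in>S. bracket x y \<in> S)"

end

text \<open>Structure preservation on the subset \<open>S\<close> only: when \<open>S\<close> is a Lie subalgebra of the domain,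
  this says that the restriction of \<open>f\<close> to \<open>S\<close> is a homomorphism of Lie algebras.\<close>

definition lie_hom_on :: "'a set \<Rightarrow> ('k::field \<Rightarrow> 'a::ab_group_add \<Rightarrow> 'a) \<Rightarrow> ('a \<Rightarrow> 'a \<Rightarrow> 'a)
    \<Rightarrow> ('k \<Rightarrow> 'b::ab_group_add \<Rightarrow> 'b) \<Rightarrow> ('b \<Rightarrow> 'b \<Rightarrow> 'b) \<Rightarrow> ('a \<Rightarrow> 'b) \<Rightarrow> bool" where
  "lie_hom_on S sA brA sB brB f \<longleftrightarrow>
     (\<forall>x\<in>S. \<forall>y\<in>S. f (x + y) = f x + f y) \<and>
     (\<forall>c. \<forall>x\<in>S. f (sA c x) = sB c (f x)) \<and>
     (\<forall>x\<in>S. \<forall>y\<in>S. f (brA x y) = brB (f x) (f y))"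

abbreviation lie_hom :: "('k::field \<Rightarrow> 'a::ab_group_add \<Rightarrow> 'a) \<Rightarrow> ('a \<Rightarrow> 'a \<Rightarrow> 'a)
    \<Rightarrow> ('k \<Rightarrow> 'b::ab_group_add \<Rightarrow> 'b) \<Rightarrow> ('b \<Rightarrow> 'b \<Rightarrow> 'b) \<Rightarrow> ('a \<Rightarrow> 'b) \<Rightarrow> bool" where
  "lie_hom \<equiv> lie_hom_on UNIV"

definition prod_bracket :: "('a \<Rightarrow> 'a \<Rightarrow> 'a) \<Rightarrow> ('b \<Rightarrow> 'b \<Rightarrow> 'b) \<Rightarrow> 'a \<times> 'b \<Rightarrow> 'a \<times> 'b \<Rightarrow> 'a \<times> 'b" where
  "prod_bracket brA brB p q = (brA (fst p) (fst q), brB (snd p) (snd q))"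

definition bilinear_map :: "('k::field \<Rightarrow> 'a::ab_group_add \<Rightarrow> 'a) \<Rightarrow> ('k \<Rightarrow> 'b::ab_group_add \<Rightarrow> 'b)
    \<Rightarrow> ('k \<Rightarrow> 'c::ab_group_add \<Rightarrow> 'c) \<Rightarrow> ('a \<Rightarrow> 'b \<Rightarrow> 'c) \<Rightarrow> bool" where
  "bilinear_map sA sB sC f \<longleftrightarrow>
     (\<forall>x. Vector_Spaces.linear sB sC (f x)) \<and> (\<forall>y. Vector_Spaces.linear sA sC (\<lambda>x. f x y))"

definition composable :: "('a \<Rightarrow> 'b) \<Rightarrow> ('a \<Rightarrow> 'b) \<Rightarrow> ('a \<times> 'a) set" where
  "composable s t = {(x, y). t x = s y}"

text \<open>The composition \<open>k\<close> is a total function on pairs, but only its values on composable pairs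
  are constrained. Composition is written in diagrammatic order.\<close>

locale categorical_lie_algebra =
  C1: lie_algebra scale1 bracket1 + C0: lie_algebra scale0 bracket0
  for scale1 :: "'k::field \<Rightarrow> 'c1::ab_group_add \<Rightarrow> 'c1"
    and bracket1 :: "'c1 \<Rightarrow> 'c1 \<Rightarrow> 'c1"
    and scale0 :: "'k \<Rightarrow> 'c0::ab_group_add \<Rightarrow> 'c0"
    and bracket0 :: "'c0 \<Rightarrow> 'c0 \<Rightarrow> 'c0" +
  fixes s t :: "'c1 \<Rightarrow> 'c0"
    and e :: "'c0 \<Rightarrow> 'c1"
    and k :: "'c1 \<times> 'c1 \<Rightarrow> 'c1"
  assumes s_hom: "lie_hom scale1 bracket1 scale0 bracket0 s"
    and t_hom: "lie_hom scale1 bracket1 scale0 bracket0 t"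
    and e_hom: "lie_hom scale0 bracket0 scale1 bracket1 e"
    and k_hom: "lie_hom_on (composable s t)
          (module_prod.scale scale1 scale1) (prod_bracket bracket1 bracket1) scale1 bracket1 k"
    and s_e: "s (e a) = a"
    and t_e: "t (e a) = a"
    and s_k: "(x, y) \<in> composable s t \<Longrightarrow> s (k (x, y)) = s x"
    and t_k: "(x, y) \<in> composable s t \<Longrightarrow> t (k (x, y)) = t y"
    and k_unit_left: "k (e (s x), x) = x"
    and k_unit_right: "k (x, e (t x)) = x"
    and k_assoc: "\<lbrakk>(x, y) \<in> composable s t; (y, z) \<in> composable s t\<rbrakk>
          \<Longrightarrow> k (k (x, y), z) = k (x, k (y, z))"

text \<open>The domain of \<open>k\<close> is indeed a Lie algebra: the product of Lie algebras is one, and the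
  composable pairs form a Lie subalgebra of \<open>C\<^sub>1 \<times> C\<^sub>1\<close>.\<close>

lemma lie_algebra_prod:
  assumes "lie_algebra sA brA" "lie_algebra sB brB"
  shows "lie_algebra (module_prod.scale sA sB) (prod_bracket brA brB)"
proof -
  interpret A: lie_algebra sA brA by fact
  interpret B: lie_algebra sB brB by fact
  interpret P: vector_space_prod sA sB ..
  note lin = A.bracket_linear_right A.bracket_linear_left B.bracket_linear_right B.bracket_linear_left
  note h = lin[THEN module_hom_linearI, THEN module_hom.add] lin[THEN module_hom_linearI, THEN module_hom.scale]
  show ?thesis
  proof
    show "prod_bracket brA brB x x = 0" for x
      by (simp add: prod_bracket_def A.bracket_self B.bracket_self zero_prod_def)
    show "prod_bracket brA brB x (prod_bracket brA brB y z) +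
          prod_bracket brA brB y (prod_bracket brA brB z x) +
          prod_bracket brA brB z (prod_bracket brA brB x y) = 0" for x y z
      by (simp add: prod_bracket_def A.jacobi B.jacobi zero_prod_def)
  qed (auto simp: prod_bracket_def P.scale_def h)
qed

lemma (in categorical_lie_algebra) lie_subalgebra_composable:
  "lie_algebra.lie_subalgebra (module_prod.scale scale1 scale1) (prod_bracket bracket1 bracket1)
     (composable s t)"
proof -
  interpret P: vector_space_prod scale1 scale1 ..
  interpret L: lie_algebra "module_prod.scale scale1 scale1" "prod_bracket bracket1 bracket1"
    by (intro lie_algebra_prod C1.lie_algebra_axioms)
  have add: "s (x + y) = s x + s y" "t (x + y) = t x + t y" for x y
    using s_hom t_hom by (auto simp: lie_hom_on_def)
  have zero: "s 0 = 0" "t 0 = 0"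
    using add[of 0 0] by simp_all
  show ?thesis
    using s_hom t_hom zero
    unfolding L.lie_subalgebra_def P.p.subspace_def
    by (auto simp: composable_def lie_hom_on_def prod_bracket_def P.scale_def zero_prod_def)
qed

end

theory Submission
  imports Defs
begin

text \<open>In a categorical Lie algebra the composition is forced to be \<open>k (x, y) = x + y - e (t x)\<close>.
  Hence (ii) becomes a formula for \<open>[x, y] + [x, y]\<close> in terms of \<open>\<tau>\<close> and \<open>e\<close>. For \<open>x = e a\<close> and
  \<open>y = \<tau> b c\<close> source and target of \<open>y\<close> are opposite, so the terms in \<open>e\<close> cancel and those in \<open>\<tau>\<close>
  double.\<close>

lemma (in lie_algebra) bracket_add_left: "bracket (x + y) z = bracket x z + bracket y z"
  by (rule module_hom.add[OF bracket_linear_left[THEN module_hom_linearI]])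

lemma (in lie_algebra) bracket_add_right: "bracket x (y + z) = bracket x y + bracket x z"
  by (rule module_hom.add[OF bracket_linear_right[THEN module_hom_linearI]])

lemma (in lie_algebra) bracket_neg_left: "bracket (- x) y = - bracket x y"
  by (rule module_hom.neg[OF bracket_linear_left[THEN module_hom_linearI]])

lemma (in lie_algebra) bracket_neg_right: "bracket x (- y) = - bracket x y"
  by (rule module_hom.neg[OF bracket_linear_right[THEN module_hom_linearI]])

text \<open>Polarization: expand \<open>[y + x, y + x] = 0\<close> and drop the two squares.\<close>

lemma (in lie_algebra) bracket_skew: "bracket x y = - bracket y x"
  using bracket_self[of "y + x"] unfolding bracket_add_left bracket_add_right
  by (simp add: bracket_self eq_neg_iff_add_eq_0)

text \<open>If 2 vanished, the characteristic would divide 2; being different from 2 it would be 1,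
  which is impossible since \<open>1 \<noteq> 0\<close>.\<close>

lemma two_neq_zero_if_CHAR_neq_2:
  assumes "CHAR('k::idom) \<noteq> 2"
  shows "(2::'k) \<noteq> 0"
proof
  assume "(2::'k) = 0"
  then have "of_nat 2 = (0::'k)"
    by simp
  then have "CHAR('k) dvd 2"
    by (simp only: of_nat_eq_0_iff_char_dvd)
  then have "CHAR('k) = 1"
    using assms dvd_imp_le[of "CHAR('k)" 2] dvd_pos_nat[of 2 "CHAR('k)"] by linarith
  then show False
    by simp
qed

text \<open>This is how the hypothesis on the characteristic enters: doubling is scaling by 2, a
  nonzero scalar.\<close>

lemma (in vector_space) double_cancel:
  assumes "CHAR('a) \<noteq> 2" and "x + x = y + (y :: 'b)"
  shows "x = y"
proof -
  have "scale 2 x = scale 2 y"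
    using assms(2) scale_left_distrib[of 1 1] by simp
  then show ?thesis
    using two_neq_zero_if_CHAR_neq_2[OF assms(1)] by simp
qed

context categorical_lie_algebra
begin

lemma s_add: "s (x + y) = s x + s y"
  and s_bracket: "s (bracket1 x y) = bracket0 (s x) (s y)"
  and t_add: "t (x + y) = t x + t y"
  and t_bracket: "t (bracket1 x y) = bracket0 (t x) (t y)"
  and e_add: "e (a + b) = e a + e b"
  using s_hom t_hom e_hom by (auto simp: lie_hom_on_def)

lemma s_diff: "s (x - y) = s x - s y"
  using s_add[of "x - y" y] by (simp add: algebra_simps)

lemma t_zero: "t 0 = 0" and e_zero: "e 0 = 0"
  using t_add[of 0 0] e_add[of 0 0] by simp_all

lemma e_neg: "e (- a) = - e a"
  using e_add[of "- a" a] by (simp add: e_zero eq_neg_iff_add_eq_0)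

text \<open>Additivity of \<open>k\<close> on composable pairs is what forces the formula:
  \<open>(x, y)\<close> splits as \<open>(x, e (t x)) + (0, y - e (t x))\<close>, and the unit laws
  evaluate \<open>k\<close> on both summands.\<close>

lemma k_eq:
  assumes "t x = s y"
  shows "k (x, y) = x + y - e (t x)"
proof -
  let ?z = "y - e (t x)"
  have z: "s ?z = 0"
    using assms by (simp add: s_diff s_e)
  have "(x, e (t x)) \<in> composable s t" "(0, ?z) \<in> composable s t"
    using z by (simp_all add: composable_def s_e t_zero)
  then have "k ((x, e (t x)) + (0, ?z)) = k (x, e (t x)) + k (0, ?z)"
    using k_hom unfolding lie_hom_on_def by blast
  \<comment> \<open>Since \<open>s ?z = 0\<close>, the left unit for \<open>?z\<close> is
    \<open>e 0 = 0\<close>.\<close>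
  moreover have "k (0, ?z) = ?z"
    using k_unit_left[of ?z] z by (simp add: e_zero)
  ultimately show ?thesis
    by (simp add: k_unit_right algebra_simps)
qed

text \<open>Expand both sides of \<open>nat\<close> by \<open>k_eq\<close>. The right side contains
  \<open>[y, x] = - [x, y]\<close>, so collecting brackets on the left gives \<open>[x, y]\<close>
  twice.\<close>

lemma double_bracket_eq:
  assumes st: "\<And>a b. s (\<tau> a b) = bracket0 a b" "\<And>a b. t (\<tau> a b) = bracket0 b a"
    and nat: "k (bracket1 x y, \<tau> (t x) (t y)) = k (\<tau> (s x) (s y), bracket1 y x)"
  shows "bracket1 x y + bracket1 x y =
    \<tau> (s x) (s y) - \<tau> (t x) (t y) + e (bracket0 (t x) (t y)) + e (bracket0 (s x) (s y))"
proof -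
  \<comment> \<open>The pair is composable: \<open>t [x, y]\<close> and the source of
    \<open>\<tau> (t x) (t y)\<close> both equal \<open>[t x, t y]\<close>.\<close>
  have "k (bracket1 x y, \<tau> (t x) (t y)) = bracket1 x y + \<tau> (t x) (t y) - e (bracket0 (t x) (t y))"
    by (simp add: k_eq st t_bracket)
  moreover have "k (\<tau> (s x) (s y), bracket1 y x) =
      \<tau> (s x) (s y) + bracket1 y x - e (bracket0 (s y) (s x))"
    by (simp add: k_eq st s_bracket)
  moreover have "bracket1 y x = - bracket1 x y"
    by (rule C1.bracket_skew)
  moreover have "e (bracket0 (s y) (s x)) = - e (bracket0 (s x) (s y))"
    using C0.bracket_skew[of "s y" "s x"] by (simp only: e_neg)
  ultimately have "bracket1 x y + \<tau> (t x) (t y) - e (bracket0 (t x) (t y)) =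
      \<tau> (s x) (s y) - bracket1 x y + e (bracket0 (s x) (s y))"
    using nat by simp
  then show ?thesis
    by (simp add: algebra_simps)
qed

end

theorem proposition4p5:
  fixes scale1 :: "'k::field \<Rightarrow> 'c1::ab_group_add \<Rightarrow> 'c1"
    and bracket1 :: "'c1 \<Rightarrow> 'c1 \<Rightarrow> 'c1"
    and scale0 :: "'k \<Rightarrow> 'c0::ab_group_add \<Rightarrow> 'c0"
    and bracket0 :: "'c0 \<Rightarrow> 'c0 \<Rightarrow> 'c0"
    and s t :: "'c1 \<Rightarrow> 'c0"
    and e :: "'c0 \<Rightarrow> 'c1"
    and k :: "'c1 \<times> 'c1 \<Rightarrow> 'c1"
    and \<tau> :: "'c0 \<Rightarrow> 'c0 \<Rightarrow> 'c1"
  assumes "CHAR('k) \<noteq> 2"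
    and "categorical_lie_algebra scale1 bracket1 scale0 bracket0 s t e k"
    and "bilinear_map scale0 scale0 scale1 \<tau>"
    and "\<forall>a b. s (\<tau> a b) = bracket0 a b \<and> t (\<tau> a b) = bracket0 b a"
    and "\<forall>x y. k (bracket1 x y, \<tau> (t x) (t y)) = k (\<tau> (s x) (s y), bracket1 y x)"
  shows "\<forall>a b c. \<tau> a (bracket0 b c) = bracket1 (e a) (\<tau> b c) \<and>
                 \<tau> (bracket0 b c) a = bracket1 (\<tau> b c) (e a) \<and>
                 \<tau> a (bracket0 b c) = - \<tau> (bracket0 b c) a"
proof -
  interpret categorical_lie_algebra scale1 bracket1 scale0 bracket0 s t e k
    by fact
  have st: "s (\<tau> a b) = bracket0 a b" "t (\<tau> a b) = bracket0 b a" for a b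
    using assms(4) by auto
  have lin: "Vector_Spaces.linear scale0 scale1 (\<tau> a)"
    "Vector_Spaces.linear scale0 scale1 (\<lambda>x. \<tau> x a)" for a
    using assms(3) by (auto simp: bilinear_map_def)
  have neg: "\<tau> a (- b) = - \<tau> a b" "\<tau> (- a) b = - \<tau> a b" for a b
    using lin[THEN module_hom_linearI, THEN module_hom.neg] by auto
  have double: "bracket1 x y + bracket1 x y =
    \<tau> (s x) (s y) - \<tau> (t x) (t y) + e (bracket0 (t x) (t y)) + e (bracket0 (s x) (s y))" for x y
    using assms(5) by (intro double_bracket_eq st) auto
  \<comment> \<open>Written as minus the source, so that the sign can be pulled out of
    \<open>\<tau>\<close>, the bracket and \<open>e\<close>.\<close>
  have t_eq: "t (\<tau> b c) = - bracket0 b c" for b c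
    using C0.bracket_skew[of c b] by (simp only: st)
  have right: "\<tau> a (bracket0 b c) = bracket1 (e a) (\<tau> b c)" for a b c
  proof (rule C1.double_cancel[OF assms(1)])
    show "\<tau> a (bracket0 b c) + \<tau> a (bracket0 b c) =
        bracket1 (e a) (\<tau> b c) + bracket1 (e a) (\<tau> b c)"
      \<comment> \<open>Here \<open>s x = t x = a\<close> and \<open>s y = - t y = [b, c]\<close>:
        \<open>- \<tau> a (- [b, c])\<close> becomes a second \<open>\<tau> a [b, c]\<close>, while
        \<open>e [a, - [b, c]]\<close> cancels \<open>e [a, [b, c]]\<close>.\<close>
      unfolding double by (simp add: s_e t_e st(1) t_eq neg C0.bracket_neg_right e_neg)
  qed
  have left: "\<tau> (bracket0 b c) a = bracket1 (\<tau> b c) (e a)" for a b c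
  proof (rule C1.double_cancel[OF assms(1)])
    show "\<tau> (bracket0 b c) a + \<tau> (bracket0 b c) a =
        bracket1 (\<tau> b c) (e a) + bracket1 (\<tau> b c) (e a)"
      unfolding double by (simp add: s_e t_e st(1) t_eq neg C0.bracket_neg_left e_neg)
  qed
  show ?thesis
    \<comment> \<open>With both identities substituted, the last claim is skew symmetry in
      \<open>C1\<close>.\<close>
    unfolding right left using C1.bracket_skew by blast
qed

end
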